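(* Suppose $u\in\mathcal A^{k,r}$, $d=kr$, with either $r\in(0,1)$, $k\in(0,\frac1r]$, or $r<0$, $k\in[\frac1r,0)$. For any price vector $p\in\mathbb R^n_+$ with positive entries and any $q\in\mathbb R^n$, if $\varrho=\|q\|_p<1$, then $$\|P(x(p+q)-x(p)-\nabla x(p)[q])\|\le\frac wd\cdot\frac{T_f\,\varrho^2}{2(1-\varrho)},\qquad T_f=\max\Big\{\frac{6d}{(1-r)^2},2d\Big\}.$$
   Context: $u\in\mathcal A^{k,r}$ (for real $k\neq0,r\ne0$ with $d=kr>0$) means $u(x)=(\sum_{j=1}^n\theta_j(x^{(j)}))^k$ where each $\theta_j$ is nonnegative, continuous and homogeneous of order $r$. For a budget $w>0$ and $p>0$, $x(p)$ is the best response: the unique maximizer of $\log u(x)$ over $x\in\mathbb R^n_+$ with $\langle p,x\rangle\le w$; $\nabla x(p)$ is its Jacobian. $P=\mathrm{diag}(p)$, $\|\cdot\|$ is the Euclidean norm and $\|q\|_p=\|P^{-1}q\|$. *)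

theory Defs
  imports "HOL-Analysis.Analysis"
begin

text \<open>
  For \<open>r < 0\<close> a homogeneous function of order \<open>r\<close> blows up at the boundary point \<open>0\<close>, where the
  utility \<open>(\<Sum>j. \<theta> j (x $ j)) ^ k\<close> (with \<open>k < 0\<close>) then vanishes and its logarithm is \<open>-\<infinity>\<close>.
  The summands and utilities therefore take values in \<open>[0, \<infinity>]\<close>, and logarithms in
  \<open>[-\<infinity>, \<infinity>]\<close>.
\<close>

text \<open>The power \<open>t ^ k\<close> with real exponent \<open>k \<noteq> 0\<close>, extended continuously from \<open>(0, \<infinity>)\<close> to
  \<open>[0, \<infinity>]\<close>; the case \<open>k = 0\<close> is never used.\<close>

definition ennreal_pow :: "ennreal \<Rightarrow> real \<Rightarrow> ennreal" where
  "ennreal_pow t k =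
     (if t = 0 then (if k > 0 then 0 else \<infinity>)
      else if t = \<infinity> then (if k > 0 then \<infinity> else 0)
      else ennreal (enn2real t powr k))"

definition ext_ln :: "ennreal \<Rightarrow> ereal" where
  "ext_ln t =
     (if t = 0 then - \<infinity> else if t = \<infinity> then \<infinity> else ereal (ln (enn2real t)))"

text \<open>Nonnegativity is part of the type. Finiteness is required on \<open>(0, \<infinity>)\<close> only: for \<open>r > 0\<close>,
  continuity and homogeneity give \<open>\<theta> 0 = 0\<close>, so such \<open>\<theta>\<close> are exactly the real-valued ones; for
  \<open>r < 0\<close> and \<open>\<theta>\<close> not identically zero, they give \<open>\<theta> 0 = \<infinity>\<close>.\<close>

definition homogeneous_summand :: "real \<Rightarrow> (real \<Rightarrow> ennreal) \<Rightarrow> bool" where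
  "homogeneous_summand r \<theta> \<longleftrightarrow>
     continuous_on {0..} \<theta> \<and>
     (\<forall>s>0. \<theta> s \<noteq> \<infinity>) \<and>
     (\<forall>t>0. \<forall>s\<ge>0. \<theta> (t * s) = ennreal (t powr r) * \<theta> s)"

definition utility_class :: "real \<Rightarrow> real \<Rightarrow> (real ^ 'n \<Rightarrow> ennreal) set" where
  "utility_class k r =
     {u. k \<noteq> 0 \<and> r \<noteq> 0 \<and> k * r > 0 \<and>
         (\<exists>\<theta> :: 'n \<Rightarrow> real \<Rightarrow> ennreal.
            (\<forall>j. homogeneous_summand r (\<theta> j)) \<and>
            (\<forall>x. (\<forall>j. x $ j \<ge> 0) \<longrightarrow>
                 u x = ennreal_pow (\<Sum>j\<in>UNIV. \<theta> j (x $ j)) k))}"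

definition budget_set :: "real \<Rightarrow> real ^ 'n \<Rightarrow> (real ^ 'n) set" where
  "budget_set w p = {x. (\<forall>j. x $ j \<ge> 0) \<and> p \<bullet> x \<le> w}"

definition unique_maximizer ::
    "(real ^ 'n \<Rightarrow> ennreal) \<Rightarrow> real \<Rightarrow> real ^ 'n \<Rightarrow> real ^ 'n \<Rightarrow> bool" where
  "unique_maximizer u w p y \<longleftrightarrow>
     is_arg_max (\<lambda>x. ext_ln (u x)) (\<lambda>x. x \<in> budget_set w p) y \<and>
     (\<forall>z. is_arg_max (\<lambda>x. ext_ln (u x)) (\<lambda>x. x \<in> budget_set w p) z \<longrightarrow> z = y)"

text \<open>For \<open>w > 0\<close> and positive \<open>p\<close> the unique maximizer exists for every \<open>u\<close> in the class
  with \<open>r < 1\<close>, except when all \<open>\<theta> j\<close> vanish; then \<open>u\<close> is constant and \<open>best_response\<close> is an unspecified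
  vector that does not depend on \<open>p\<close>.\<close>

definition best_response ::
    "(real ^ 'n \<Rightarrow> ennreal) \<Rightarrow> real \<Rightarrow> real ^ 'n \<Rightarrow> real ^ 'n" where
  "best_response u w p = (THE y. unique_maximizer u w p y)"

definition diag_mat :: "real ^ 'n \<Rightarrow> real ^ 'n ^ 'n" where
  "diag_mat p = (\<chi> i j. if i = j then p $ i else 0)"

definition price_norm :: "real ^ 'n \<Rightarrow> real ^ 'n \<Rightarrow> real" where
  "price_norm p q = norm (matrix_inv (diag_mat p) *v q)"

end

theory Submission
  imports Defs
begin

text \<open>
  Homogeneity turns each summand into a power, \<open>\<theta>\<^sub>j s = c\<^sub>j s\<^sup>r\<close>, so up to a monotone transformation the
  utility is a CES utility, and its best response has a closed form. With \<open>\<sigma> = 1 / (1 - r)\<close> and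
  \<open>a\<^sub>j = c\<^sub>j\<^sup>\<sigma>\<close> it is
  \<open>x\<^sub>j(p) = w a\<^sub>j p\<^sub>j\<^sup>-\<^sup>\<sigma> / (\<Sum>i. a\<^sub>i p\<^sub>i\<^sup>1\<^sup>-\<^sup>\<sigma>)\<close>
  (\<open>best_response_eq_ces_demand\<close>). Optimality is the tangent inequality
  \<open>(z\<^sup>r - 1) / r < z - 1\<close> for \<open>z \<noteq> 1\<close>, applied with \<open>z = x\<^sub>j / y\<^sub>j\<close> to every good with \<open>c\<^sub>j > 0\<close> and summed: by the
  first-order condition the slopes at the CES demand \<open>y\<close> are proportional to the prices, and \<open>y\<close>
  spends the whole budget. Dividing by \<open>r\<close> treats both signs of \<open>r\<close> at once.

  For the error bound, fix a unit vector \<open>e\<close> and follow the scalar function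
  \<open>f t = \<langle>e, P x(p + t q)\<rangle> = w A t / S t\<close> on \<open>[0, 1]\<close>, where \<open>A\<close> and \<open>S\<close> are sums of powers of the
  prices \<open>\<pi>\<^sub>j = p\<^sub>j + t q\<^sub>j\<close>. The quantities \<open>\<omega>\<^sub>j = a\<^sub>j \<pi>\<^sub>j\<^sup>1\<^sup>-\<^sup>\<sigma>\<close> sum to \<open>S\<close>, so they act as weights, and every
  one of \<open>A\<close>, \<open>S\<close> and their first two derivatives, divided by \<open>S\<close>, is a constant times a weighted
  average of products of \<open>\<epsilon>\<^sub>j = e\<^sub>j p\<^sub>j / \<pi>\<^sub>j\<close> and \<open>\<eta>\<^sub>j = q\<^sub>j / \<pi>\<^sub>j\<close>. Since \<open>\<bar>\<epsilon>\<^sub>j\<bar> \<le> M\<close> and \<open>\<bar>\<eta>\<^sub>j\<bar> \<le> \<rho> M\<close> with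
  \<open>M = 1 / (1 - t \<rho>)\<close>, all terms of \<open>f''\<close> are of size \<open>\<rho>\<^sup>2 M\<^sup>3\<close>, and the coefficients add up to at
  most \<open>max (6 \<sigma>\<^sup>2) 2\<close>. This constant equals \<open>T / d\<close>, so \<open>d\<close> cancels from the claim. Integrating
  \<open>\<rho>\<^sup>2 / (1 - t \<rho>)\<^sup>3\<close> twice gives \<open>\<rho>\<^sup>2 / (2 (1 - \<rho>))\<close>, and the supremum over \<open>e\<close> gives the norm.

  If all summands vanish, no positive price vector has a unique maximizer; the best response is then the
  same vector at all positive prices and there is nothing to estimate.
\<close>

section \<open>Homogeneous summands are powers\<close>

lemma homogeneous_summand_eq_powr:
  assumes "homogeneous_summand r \<theta>" and "s > 0"
  shows "\<theta> s = ennreal (enn2real (\<theta> 1) * s powr r)"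
proof -
  have "\<theta> (s * 1) = ennreal (s powr r) * \<theta> 1"
    using assms(2) assms(1)[unfolded homogeneous_summand_def] zero_le_one by blast
  moreover have "\<theta> 1 = ennreal (enn2real (\<theta> 1))"
    using assms unfolding homogeneous_summand_def by (simp add: top.not_eq_extremum)
  ultimately show ?thesis
    by (metis ennreal_mult enn2real_nonneg mult.commute mult.right_neutral powr_ge_zero)
qed

lemma homogeneous_summand_tendsto_0:
  assumes "homogeneous_summand r \<theta>"
  shows "((\<lambda>s. ennreal (enn2real (\<theta> 1) * s powr r)) \<longlongrightarrow> \<theta> 0) (at_right 0)"
proof -
  have "(\<theta> \<longlongrightarrow> \<theta> 0) (at 0 within {0..})"
    using assms unfolding homogeneous_summand_def continuous_on_def by auto
  then have "(\<theta> \<longlongrightarrow> \<theta> 0) (at_right 0)"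
    by (rule tendsto_within_subset) auto
  moreover have "eventually (\<lambda>s. \<theta> s = ennreal (enn2real (\<theta> 1) * s powr r)) (at_right 0)"
    using eventually_at_right_less[of "0::real"]
    by (rule eventually_mono) (use assms homogeneous_summand_eq_powr in blast)
  ultimately show ?thesis
    using tendsto_cong by fast
qed

lemma powr_at_right_0_at_top:
  fixes r :: real
  assumes "r < 0"
  shows "filterlim (\<lambda>s. s powr r) at_top (at_right 0)"
proof -
  have "filterlim (\<lambda>s. r * ln s) at_top (at_right 0)"
    by (rule iffD2[OF filterlim_tendsto_neg_mult_at_top_iff[OF tendsto_const assms] ln_at_0])
  then have "filterlim (\<lambda>s. exp (r * ln s)) at_top (at_right 0)"
    by (rule filterlim_compose[OF exp_at_top])
  moreover have "eventually (\<lambda>s. exp (r * ln s) = s powr r) (at_right 0)"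
    using eventually_at_right_less[of "0::real"]
    by (rule eventually_mono) (simp add: powr_def)
  ultimately show ?thesis
    using filterlim_cong by fast
qed

text \<open>
  The power formula extends to the boundary point \<open>0\<close> by continuity, whenever the limit is
  finite. As \<open>0 powr r = 0\<close>, one formula covers \<open>r > 0\<close> and also the vanishing summands for \<open>r < 0\<close>.
\<close>

lemma homogeneous_summand_finite:
  assumes "homogeneous_summand r \<theta>" and "s \<ge> 0"
    and "r > 0 \<or> (r < 0 \<and> (enn2real (\<theta> 1) > 0 \<longrightarrow> s > 0))"
  shows "\<theta> s = ennreal (enn2real (\<theta> 1) * s powr r)"
proof (cases "s > 0")
  case False
  then have "s = 0" using assms by simp
  have "((\<lambda>s. ennreal (enn2real (\<theta> 1) * s powr r)) \<longlongrightarrow> ennreal 0) (at_right 0)"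
  proof (cases "r > 0")
    case True
    have "((\<lambda>s. s) \<longlongrightarrow> (0::real)) (at_right 0)"
      by (simp add: tendsto_ident_at)
    moreover have "eventually (\<lambda>s::real. 0 \<le> s) (at_right 0)"
      using eventually_at_right_less[of "0::real"] by (rule eventually_mono) simp
    ultimately have "((\<lambda>s. s powr r) \<longlongrightarrow> 0) (at_right 0)"
      using tendsto_zero_powrI tendsto_const[of r] True by blast
    then have "((\<lambda>s. enn2real (\<theta> 1) * s powr r) \<longlongrightarrow> 0) (at_right 0)"
      by (rule tendsto_mult_right_zero)
    then show ?thesis by (rule tendsto_ennrealI)
  next
    case False
    then have "enn2real (\<theta> 1) = 0"
      using assms \<open>s = 0\<close> enn2real_nonneg[of "\<theta> 1"] by linarith
    then show ?thesis by simp
  qed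
  with homogeneous_summand_tendsto_0[OF assms(1)] have "\<theta> 0 = ennreal 0"
    by (meson tendsto_unique trivial_limit_at_right_real)
  then show ?thesis using \<open>s = 0\<close> by simp
qed (use assms homogeneous_summand_eq_powr in blast)

lemma homogeneous_summand_infinite:
  assumes "homogeneous_summand r \<theta>" and "r < 0" and "enn2real (\<theta> 1) > 0"
  shows "\<theta> 0 = \<infinity>"
proof -
  have "filterlim (\<lambda>s. enn2real (\<theta> 1) * s powr r) at_top (at_right 0)"
    by (rule filterlim_tendsto_pos_mult_at_top[OF tendsto_const assms(3) powr_at_right_0_at_top[OF assms(2)]])
  then have "((\<lambda>s. ennreal (enn2real (\<theta> 1) * s powr r)) \<longlongrightarrow> top) (at_right 0)"
    by (simp add: ennreal_tendsto_top_eq_at_top)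
  with homogeneous_summand_tendsto_0[OF assms(1)] show ?thesis
    unfolding infinity_ennreal_def by (meson tendsto_unique trivial_limit_at_right_real)
qed

section \<open>Optimality of the CES demand\<close>

text \<open>
  The function \<open>z\<^sup>r / r\<close> is strictly concave for \<open>r < 1\<close> and has slope \<open>1\<close> at \<open>z = 1\<close>, so it lies
  strictly below its tangent there. The strictness is what makes the maximizer unique.
\<close>

lemma powr_tangent_strict:
  fixes r z :: real
  assumes "r < 1" and "r \<noteq> 0" and "z \<ge> 0" and "r < 0 \<longrightarrow> z > 0" and "z \<noteq> 1"
  shows "(z powr r - 1) / r < z - 1"
proof (cases "z = 0")
  case True
  then show ?thesis using assms by (auto simp: field_simps)
next
  case False
  then have "z > 0" using assms by simp
  have deriv: "((\<lambda>z. z powr r) has_real_derivative r * x powr (r - 1)) (at x)" if "x > 0" for x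
    using that by (auto intro!: derivative_eq_intros)
  show ?thesis
  proof (cases "z > 1")
    case True
    then obtain x where x: "1 < x" "x < z" "z powr r - 1 powr r = (z - 1) * (r * x powr (r - 1))"
      using MVT2[of 1 z "\<lambda>z. z powr r" "\<lambda>x. r * x powr (r - 1)"] deriv by auto
    have "x powr (r - 1) < 1"
      using x assms by (simp add: powr_less_one)
    then have "(z - 1) * x powr (r - 1) < (z - 1) * 1"
      using True by (intro mult_strict_left_mono) auto
    then show ?thesis using x assms by simp
  next
    case False
    then have "z < 1" using assms by simp
    then obtain x where x: "z < x" "x < 1" "1 powr r - z powr r = (1 - z) * (r * x powr (r - 1))"
      using MVT2[of z 1 "\<lambda>z. z powr r" "\<lambda>x. r * x powr (r - 1)"] deriv \<open>z > 0\<close> by auto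
    have "x powr (1 - r) < 1 powr (1 - r)"
      using x assms \<open>z > 0\<close> by (intro powr_less_mono2) auto
    moreover have "x powr (r - 1) = inverse (x powr (1 - r))"
      by (metis powr_minus minus_diff_eq)
    moreover have "x powr (1 - r) > 0" using x \<open>z > 0\<close> by simp
    ultimately have "x powr (r - 1) > 1"
      by (simp add: one_less_inverse)
    then have "(1 - z) * 1 < (1 - z) * x powr (r - 1)"
      using \<open>z < 1\<close> by (intro mult_strict_left_mono) auto
    moreover have "(z powr r - 1) / r = - ((1 - z) * x powr (r - 1))"
      using x(3) assms by (simp add: field_simps)
    ultimately show ?thesis by simp
  qed
qed

text \<open>
  The demand of an agent with constant elasticity of substitution \<open>\<sigma>\<close>. The quantity in the
  denominator is the power \<open>1 - \<sigma>\<close> of the CES price index.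
\<close>

definition ces_demand :: "('n \<Rightarrow> real) \<Rightarrow> real \<Rightarrow> real \<Rightarrow> real ^ 'n \<Rightarrow> real ^ 'n" where
  "ces_demand a \<sigma> w p =
     (\<chi> j. w * a j * (p $ j) powr (- \<sigma>) / (\<Sum>i\<in>UNIV. a i * (p $ i) powr (1 - \<sigma>)))"

lemma ces_price_index_pos:
  fixes p :: "real ^ 'n"
  assumes "\<forall>j. a j \<ge> 0" and "\<exists>j. a j > 0" and "\<forall>j. p $ j > 0"
  shows "(\<Sum>i\<in>UNIV. a i * (p $ i) powr \<kappa>) > 0"
proof -
  obtain j where "a j > 0" using assms by blast
  moreover have "p $ j > 0" using assms by blast
  ultimately have "a j * (p $ j) powr \<kappa> > 0" by (intro mult_pos_pos) auto
  then show ?thesis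
    using assms by (intro sum_pos2[of _ j]) auto
qed

lemma ces_demand_exhausts_budget:
  fixes p :: "real ^ 'n"
  assumes "\<forall>j. a j \<ge> 0" and "\<exists>j. a j > 0" and "\<forall>j. p $ j > 0"
  shows "p \<bullet> ces_demand a \<sigma> w p = w"
proof -
  define S where "S = (\<Sum>i\<in>UNIV. a i * (p $ i) powr (1 - \<sigma>))"
  have "S > 0" using ces_price_index_pos[OF assms] S_def by simp
  have "p $ j * (p $ j) powr (- \<sigma>) = (p $ j) powr (1 - \<sigma>)" for j
    using assms(3) by (simp add: powr_mult_base less_imp_le)
  then have eq: "p $ j * (w * a j * (p $ j) powr (- \<sigma>) / S) = w / S * (a j * (p $ j) powr (1 - \<sigma>))" for j
    by (metis (no_types, opaque_lifting) mult.assoc mult.left_commute times_divide_eq_left times_divide_eq_right)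
  have "p \<bullet> ces_demand a \<sigma> w p = (\<Sum>j\<in>UNIV. p $ j * (w * a j * (p $ j) powr (- \<sigma>) / S))"
    by (simp add: ces_demand_def inner_vec_def S_def)
  also have "\<dots> = w / S * S"
    by (simp only: eq) (simp add: S_def sum_distrib_left)
  finally have "p \<bullet> ces_demand a \<sigma> w p = w / S * S" .
  then show ?thesis using \<open>S > 0\<close> by simp
qed

text \<open>
  At the CES demand the marginal value \<open>c\<^sub>j x\<^sub>j\<^sup>r\<^sup>-\<^sup>1\<close> per unit of price is the same number \<open>\<mu>\<close> for all
  goods with \<open>c\<^sub>j > 0\<close>; \<open>\<mu>\<close> is the Lagrange multiplier up to the factor \<open>r\<close>. The equation is stated
  multiplied by \<open>x\<^sub>j\<close>, the form in which the tangent inequality uses it.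
\<close>

lemma ces_first_order_condition:
  fixes p :: "real ^ 'n"
  assumes "r < 1" and "\<forall>j. c j \<ge> 0" and "c j > 0" and "w > 0" and "\<forall>j. p $ j > 0"
  defines "a \<equiv> \<lambda>j. c j powr (1 / (1 - r))"
  defines "x \<equiv> ces_demand a (1 / (1 - r)) w p"
  defines "\<mu> \<equiv> (w / (\<Sum>i\<in>UNIV. a i * (p $ i) powr (1 - 1 / (1 - r)))) powr (r - 1)"
  shows "c j * (x $ j) powr r = \<mu> * p $ j * x $ j" and "x $ j > 0" and "\<mu> > 0"
proof -
  define S where "S = (\<Sum>i\<in>UNIV. a i * (p $ i) powr (1 - 1 / (1 - r)))"
  have a: "\<forall>j. a j \<ge> 0" "a j > 0" using assms by auto
  then have S: "S > 0" using ces_price_index_pos[OF a(1) _ assms(5)] S_def by blast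
  have pj: "p $ j > 0" using assms by blast
  have x: "x $ j = (w / S) * (c j powr (1 / (1 - r)) * (p $ j) powr (- (1 / (1 - r))))"
    unfolding x_def ces_demand_def S_def a_def by simp
  show x_pos: "x $ j > 0" unfolding x using S assms(3,4) pj by (intro mult_pos_pos divide_pos_pos) auto
  have "(x $ j) powr (r - 1) = \<mu> * (c j powr (1 / (1 - r) * (r - 1)) * (p $ j) powr (- (1 / (1 - r)) * (r - 1)))"
    unfolding x \<mu>_def S_def[symmetric] using S assms(4) pj
    by (simp only: powr_mult powr_powr)
  also have "1 / (1 - r) * (r - 1) = -1" using assms(1) by (simp add: field_simps)
  also have "- (1 / (1 - r)) * (r - 1) = 1" using assms(1) by (simp add: field_simps)
  finally have "(x $ j) powr (r - 1) = \<mu> * (p $ j / c j)"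
    using assms(3) pj by (simp add: powr_minus_divide)
  then have "c j * (x $ j) powr (r - 1) = \<mu> * p $ j" using assms(3) by simp
  moreover have "(x $ j) powr r = x $ j * (x $ j) powr (r - 1)"
    using x_pos by (simp add: powr_mult_base)
  ultimately show "c j * (x $ j) powr r = \<mu> * p $ j * x $ j" by simp
  show "\<mu> > 0" unfolding \<mu>_def S_def[symmetric] using S assms(4) by simp
qed

text \<open>
  Each good satisfies \<open>(c\<^sub>j x\<^sub>j\<^sup>r - c\<^sub>j y\<^sub>j\<^sup>r) / r \<le> \<mu> p\<^sub>j (x\<^sub>j - y\<^sub>j)\<close>, strictly if \<open>x\<^sub>j \<noteq> y\<^sub>j\<close>. The right-hand
  sides sum to \<open>\<mu> (\<langle>p, x\<rangle> - w) \<le> 0\<close>. A good with \<open>c\<^sub>j = 0\<close> has \<open>y\<^sub>j = 0\<close>, and buying it is a strict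
  loss because it only uses up money.
\<close>

lemma ces_demand_strictly_optimal:
  fixes p x :: "real ^ 'n"
  assumes "r < 1" and "r \<noteq> 0" and "\<forall>j. c j \<ge> 0" and "\<exists>j. c j > 0" and "w > 0" and "\<forall>j. p $ j > 0"
  defines "y \<equiv> ces_demand (\<lambda>j. c j powr (1 / (1 - r))) (1 / (1 - r)) w p"
  assumes "x \<in> budget_set w p" and "r < 0 \<longrightarrow> (\<forall>j. c j > 0 \<longrightarrow> x $ j > 0)" and "x \<noteq> y"
  shows "(\<Sum>j\<in>UNIV. c j * (x $ j) powr r) / r < (\<Sum>j\<in>UNIV. c j * (y $ j) powr r) / r"
proof -
  define \<mu> where "\<mu> = (w / (\<Sum>i\<in>UNIV. c i powr (1 / (1 - r)) * (p $ i) powr (1 - 1 / (1 - r)))) powr (r - 1)"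
  note foc = ces_first_order_condition[OF assms(1,3) _ assms(5,6), folded y_def \<mu>_def]
  have \<mu>: "\<mu> > 0" using foc(3) assms(4) by blast
  have strict: "(c j * (x $ j) powr r - c j * (y $ j) powr r) / r < \<mu> * p $ j * (x $ j - y $ j)"
    if ne: "x $ j \<noteq> y $ j" for j
  proof (cases "c j > 0")
    case True
    define z where "z = x $ j / y $ j"
    have yj: "y $ j > 0" using foc True by blast
    have xz: "x $ j = z * y $ j" using yj by (simp add: z_def)
    have xj: "x $ j \<ge> 0" using assms(8) by (simp add: budget_set_def)
    have "z \<ge> 0" "z \<noteq> 1" "r < 0 \<longrightarrow> z > 0"
      using xj yj ne assms(9) True by (auto simp: z_def)
    then have "(z powr r - 1) / r < z - 1"
      using powr_tangent_strict assms(1,2) by blast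
    then have "\<mu> * p $ j * y $ j * ((z powr r - 1) / r) < \<mu> * p $ j * y $ j * (z - 1)"
      using \<mu> yj assms(6) by (intro mult_strict_left_mono mult_pos_pos) auto
    moreover have "c j * (x $ j) powr r = \<mu> * p $ j * y $ j * z powr r"
      unfolding xz using \<open>z \<ge> 0\<close> yj foc(1)[OF True] by (simp add: powr_mult)
    ultimately show ?thesis
      unfolding foc(1)[OF True] by (simp add: xz algebra_simps diff_divide_distrib)
  next
    case False
    then have "c j = 0" using assms(3) by (meson antisym not_le)
    then have "y $ j = 0" by (simp add: y_def ces_demand_def)
    then have "x $ j > 0" using ne assms(8) by (simp add: budget_set_def order_less_le)
    then show ?thesis using \<open>c j = 0\<close> \<open>y $ j = 0\<close> \<mu> assms(6) by simp
  qed
  have weak: "(c j * (x $ j) powr r - c j * (y $ j) powr r) / r \<le> \<mu> * p $ j * (x $ j - y $ j)" for j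
    using strict[of j] by (cases "x $ j = y $ j") auto
  obtain i where "x $ i \<noteq> y $ i" using assms(10) by (auto simp: vec_eq_iff)
  then have "(\<Sum>j\<in>UNIV. (c j * (x $ j) powr r - c j * (y $ j) powr r) / r)
      < (\<Sum>j\<in>UNIV. \<mu> * p $ j * (x $ j - y $ j))"
    using weak strict by (intro sum_strict_mono_ex1) auto
  also have "\<dots> = \<mu> * (p \<bullet> x - p \<bullet> y)"
    by (simp add: inner_vec_def sum_distrib_left right_diff_distrib sum_subtractf mult.assoc)
  also have "p \<bullet> y = w"
    unfolding y_def using assms(4,6)
    by (intro ces_demand_exhausts_budget) (simp_all, metis less_irrefl)
  also have "\<mu> * (p \<bullet> x - w) \<le> 0"
    using \<mu> assms(8) by (simp add: budget_set_def mult_nonneg_nonpos)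
  finally show ?thesis
    by (simp add: sum_divide_distrib[symmetric] sum_subtractf diff_divide_distrib)
qed

text \<open>
  Dividing by \<open>r\<close> makes the order direction of \<open>X \<mapsto> X\<^sup>k\<close> uniform, since \<open>k\<close> and \<open>r\<close> have the same
  sign. The value \<open>X = 0\<close> can occur only for \<open>r > 0\<close>, where its logarithm is \<open>-\<infinity>\<close>.
\<close>

lemma ext_ln_ennreal_pow_strict:
  assumes "0 < r \<and> 0 < k \<or> r < 0 \<and> k < 0"
    and "Y > 0" and "X \<ge> 0" and "r < 0 \<longrightarrow> X > 0" and "X / r < Y / r"
  shows "ext_ln (ennreal_pow (ennreal X) k) < ext_ln (ennreal_pow (ennreal Y) k)"
proof -
  have finite: "ext_ln (ennreal_pow (ennreal t) k) = ereal (k * ln t)" if "t > 0" for t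
    using that by (simp add: ext_ln_def ennreal_pow_def ln_powr ennreal_eq_0_iff not_le)
  show ?thesis
  proof (cases "X = 0")
    case True
    then show ?thesis using assms finite[of Y] by (auto simp: ext_ln_def ennreal_pow_def)
  next
    case False
    then have "X > 0" using assms by simp
    have "k * ln X < k * ln Y"
      using assms \<open>X > 0\<close> by (auto simp: divide_less_cancel)
    then show ?thesis using finite assms \<open>X > 0\<close> by simp
  qed
qed

section \<open>The best response in closed form\<close>

lemma unique_maximizerI:
  assumes "y \<in> budget_set w p"
    and "\<And>z. z \<in> budget_set w p \<Longrightarrow> z \<noteq> y \<Longrightarrow> ext_ln (u z) < ext_ln (u y)"
  shows "unique_maximizer u w p y"
  using assms unfolding unique_maximizer_def is_arg_max_def
  by (metis order_less_asym)

lemma best_response_eqI: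
  assumes "unique_maximizer u w p y"
  shows "best_response u w p = y"
  unfolding best_response_def
  using assms by (rule the_equality) (use assms in \<open>auto simp: unique_maximizer_def\<close>)

text \<open>
  For \<open>r < 0\<close> a bundle that lacks some valued good has an infinite sum of summands, hence utility
  \<open>0\<close> and logarithm \<open>-\<infinity>\<close>. All other bundles have a finite sum, and the strict optimality of the CES
  demand among them decides.
\<close>

lemma best_response_eq_ces_demand:
  fixes u :: "real ^ 'n \<Rightarrow> ennreal" and p :: "real ^ 'n"
  assumes \<theta>: "\<forall>j. homogeneous_summand r (\<theta> j)"
    and u: "\<forall>x. (\<forall>j. x $ j \<ge> 0) \<longrightarrow> u x = ennreal_pow (\<Sum>j\<in>UNIV. \<theta> j (x $ j)) k"
    and sign: "0 < r \<and> 0 < k \<or> r < 0 \<and> k < 0"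
    and "r < 1" and nonzero: "\<exists>j. enn2real (\<theta> j 1) > 0" and "w > 0" and p: "\<forall>j. p $ j > 0"
  shows "best_response u w p
    = ces_demand (\<lambda>j. enn2real (\<theta> j 1) powr (1 / (1 - r))) (1 / (1 - r)) w p"
proof -
  define c where "c j = enn2real (\<theta> j 1)" for j
  define a where "a = (\<lambda>j. c j powr (1 / (1 - r)))"
  define y where "y = ces_demand a (1 / (1 - r)) w p"
  have c: "\<forall>j. c j \<ge> 0" "\<exists>j. c j > 0" using nonzero by (auto simp: c_def)
  then have a: "\<forall>j. a j \<ge> 0" "\<exists>j. a j > 0"
    unfolding a_def by (simp_all, metis less_irrefl)
  have finite_value: "u x = ennreal_pow (ennreal (\<Sum>j\<in>UNIV. c j * (x $ j) powr r)) k"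
    if x: "x \<in> budget_set w p" and inner: "r < 0 \<longrightarrow> (\<forall>j. c j > 0 \<longrightarrow> x $ j > 0)" for x
  proof -
    have "\<theta> j (x $ j) = ennreal (c j * (x $ j) powr r)" for j
      using x inner sign \<theta> unfolding c_def budget_set_def
      by (intro homogeneous_summand_finite) auto
    then have "(\<Sum>j\<in>UNIV. \<theta> j (x $ j)) = ennreal (\<Sum>j\<in>UNIV. c j * (x $ j) powr r)"
      using c(1) by (simp add: sum_ennreal)
    then show ?thesis using u x by (simp add: budget_set_def)
  qed
  have y_budget: "y \<in> budget_set w p"
  proof -
    have "p \<bullet> y = w" unfolding y_def by (rule ces_demand_exhausts_budget[OF a p])
    moreover have "y $ j \<ge> 0" for j
      using a(1) \<open>w > 0\<close> unfolding y_def ces_demand_def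
      by (auto intro!: divide_nonneg_nonneg sum_nonneg mult_nonneg_nonneg)
    ultimately show ?thesis by (simp add: budget_set_def)
  qed
  have y_pos: "y $ j > 0" if "c j > 0" for j
    using ces_first_order_condition(2)[OF \<open>r < 1\<close> c(1) that \<open>w > 0\<close> p]
    unfolding y_def a_def .
  have Y_pos: "(\<Sum>j\<in>UNIV. c j * (y $ j) powr r) > 0"
  proof -
    obtain j where "c j > 0" using c(2) by blast
    then have "c j * (y $ j) powr r > 0" using y_pos[of j] by (intro mult_pos_pos) auto
    then show ?thesis using c(1) by (intro sum_pos2[of _ j]) auto
  qed
  have "ext_ln (u z) < ext_ln (u y)" if z: "z \<in> budget_set w p" "z \<noteq> y" for z
  proof (cases "r < 0 \<longrightarrow> (\<forall>j. c j > 0 \<longrightarrow> z $ j > 0)")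
    case True
    have "(\<Sum>j\<in>UNIV. c j * (z $ j) powr r) / r < (\<Sum>j\<in>UNIV. c j * (y $ j) powr r) / r"
      unfolding y_def a_def
      using \<open>r < 1\<close> sign c \<open>w > 0\<close> p z True
      by (intro ces_demand_strictly_optimal) (auto simp: y_def a_def)
    moreover have "(\<Sum>j\<in>UNIV. c j * (z $ j) powr r) \<ge> 0"
      using c(1) by (intro sum_nonneg) auto
    moreover have "r < 0 \<longrightarrow> (\<Sum>j\<in>UNIV. c j * (z $ j) powr r) > 0"
    proof
      assume "r < 0"
      obtain j where "c j > 0" using c(2) by blast
      then have "c j * (z $ j) powr r > 0" using True \<open>r < 0\<close> by (intro mult_pos_pos) auto
      then show "(\<Sum>j\<in>UNIV. c j * (z $ j) powr r) > 0"
        using c(1) by (intro sum_pos2[of _ j]) auto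
    qed
    ultimately show ?thesis
      using finite_value[OF z(1)] finite_value[OF y_budget] True y_pos
      using ext_ln_ennreal_pow_strict[OF sign Y_pos] by auto
  next
    case False
    then obtain j where j: "r < 0" "c j > 0" "\<not> z $ j > 0" by blast
    then have "z $ j = 0" using z(1) by (metis (mono_tags) budget_set_def mem_Collect_eq order_le_less)
    then have "\<theta> j (z $ j) = \<infinity>"
      using homogeneous_summand_infinite[of r "\<theta> j"] \<theta> j by (simp add: c_def)
    then have "(\<Sum>i\<in>UNIV. \<theta> i (z $ i)) = \<infinity>"
      by (simp add: ennreal_sum_eq_top) blast
    moreover have "u z = ennreal_pow (\<Sum>i\<in>UNIV. \<theta> i (z $ i)) k"
      using u z(1) by (simp add: budget_set_def)
    moreover have "ennreal_pow \<infinity> k = 0" using sign j by (auto simp: ennreal_pow_def)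
    ultimately have "u z = 0" by (simp only:)
    then show ?thesis
      using finite_value[OF y_budget] y_pos Y_pos
      by (simp add: ext_ln_def ennreal_pow_def ennreal_eq_0_iff not_le)
  qed
  with y_budget have "unique_maximizer u w p y" by (rule unique_maximizerI)
  then show ?thesis unfolding y_def a_def c_def by (rule best_response_eqI)
qed

text \<open>
  The utility is constant, so every affordable bundle is a maximizer; the origin and the bundle
  with \<open>w / (\<Sum>j. p\<^sub>j)\<close> of each good are two of them.
\<close>

lemma no_unique_maximizer_if_summands_vanish:
  fixes u :: "real ^ 'n \<Rightarrow> ennreal" and p :: "real ^ 'n"
  assumes \<theta>: "\<forall>j. homogeneous_summand r (\<theta> j)"
    and u: "\<forall>x. (\<forall>j. x $ j \<ge> 0) \<longrightarrow> u x = ennreal_pow (\<Sum>j\<in>UNIV. \<theta> j (x $ j)) k"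
    and "r \<noteq> 0" and zero: "\<forall>j. enn2real (\<theta> j 1) = 0" and "w > 0" and p: "\<forall>j. p $ j > 0"
  shows "\<not> unique_maximizer u w p y"
proof
  assume y: "unique_maximizer u w p y"
  have const: "u x = ennreal_pow 0 k" if "x \<in> budget_set w p" for x
  proof -
    have "\<theta> j (x $ j) = ennreal (enn2real (\<theta> j 1) * (x $ j) powr r)" for j
      using that \<theta> zero \<open>r \<noteq> 0\<close> by (intro homogeneous_summand_finite) (auto simp: budget_set_def)
    then show ?thesis using that u zero by (simp add: budget_set_def)
  qed
  then have all_maximal: "x = y" if "x \<in> budget_set w p" for x
    using y that unfolding unique_maximizer_def is_arg_max_def by (metis order_less_irrefl)
  define P where "P = (\<Sum>j\<in>UNIV. p $ j)"
  have "P > 0" using p unfolding P_def by (intro sum_pos) auto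
  define x :: "real ^ 'n" where "x = (\<chi> j. w / P)"
  have "p \<bullet> x = P * (w / P)"
    by (simp add: x_def inner_vec_def P_def sum_divide_distrib sum_distrib_right)
  then have "x \<in> budget_set w p"
    using \<open>P > 0\<close> \<open>w > 0\<close> by (simp add: budget_set_def x_def)
  moreover have "0 \<in> budget_set w p" using \<open>w > 0\<close> by (simp add: budget_set_def)
  ultimately have "x = 0" using all_maximal by metis
  then show False using \<open>P > 0\<close> \<open>w > 0\<close> by (simp add: x_def vec_eq_iff)
qed

section \<open>A scalar Taylor estimate\<close>

text \<open>
  The comparison function \<open>h t = C / (2 (1 - t \<rho>))\<close> has second derivative exactly
  \<open>C \<rho>\<^sup>2 / (1 - t \<rho>)\<^sup>3\<close>, so \<open>f - h\<close> is concave and stays below its tangent at \<open>0\<close>. The remainder of \<open>h\<close>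
  itself is the right-hand side.
\<close>

lemma second_order_remainder_le:
  fixes f f' f'' :: "real \<Rightarrow> real"
  assumes "\<And>t. 0 \<le> t \<Longrightarrow> t \<le> 1 \<Longrightarrow> (f has_real_derivative f' t) (at t)"
    and "\<And>t. 0 \<le> t \<Longrightarrow> t \<le> 1 \<Longrightarrow> (f' has_real_derivative f'' t) (at t)"
    and "\<And>t. 0 \<le> t \<Longrightarrow> t \<le> 1 \<Longrightarrow> f'' t \<le> C * \<rho>\<^sup>2 / (1 - t * \<rho>) ^ 3"
    and "0 \<le> \<rho>" and "\<rho> < 1"
  shows "f 1 - f 0 - f' 0 \<le> C * \<rho>\<^sup>2 / (2 * (1 - \<rho>))"
proof -
  define h where "h t = C / 2 * inverse (1 - t * \<rho>)" for t
  define h' where "h' t = C * \<rho> / 2 * (inverse (1 - t * \<rho>))\<^sup>2" for t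
  have pos: "1 - t * \<rho> > 0" if "t \<le> 1" for t
  proof -
    have "t * \<rho> \<le> 1 * \<rho>" using that assms(4) by (intro mult_right_mono) auto
    then show ?thesis using assms(5) by simp
  qed
  have inv: "((\<lambda>t. inverse (1 - t * \<rho>)) has_real_derivative \<rho> * (inverse (1 - t * \<rho>))\<^sup>2) (at t)"
    if "t \<le> 1" for t
  proof -
    have "((\<lambda>t. 1 - t * \<rho>) has_real_derivative - \<rho>) (at t)"
      by (auto intro!: derivative_eq_intros)
    moreover have "1 - t * \<rho> \<noteq> 0" using pos[OF that] by simp
    ultimately have "((\<lambda>t. inverse (1 - t * \<rho>)) has_real_derivative
        - (inverse (1 - t * \<rho>) * (- \<rho>) * inverse (1 - t * \<rho>))) (at t)"
      by (rule DERIV_inverse')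
    then show ?thesis by (rule DERIV_cong) algebra
  qed
  have h: "(h has_real_derivative h' t) (at t)" if "t \<le> 1" for t
    unfolding h_def[abs_def] h'_def
    by (rule DERIV_cong[OF DERIV_cmult[OF inv[OF that]]]) simp
  have h': "(h' has_real_derivative C * \<rho>\<^sup>2 / (1 - t * \<rho>) ^ 3) (at t)" if "t \<le> 1" for t
  proof -
    define i where "i = inverse (1 - t * \<rho>)"
    have "(h' has_real_derivative C * \<rho> / 2 * (of_nat 2 * (\<rho> * i\<^sup>2 * i ^ (2 - Suc 0)))) (at t)"
      unfolding h'_def[abs_def] i_def
      by (rule DERIV_cmult[OF DERIV_power[OF inv[OF that]]])
    moreover have "C * \<rho> / 2 * (of_nat 2 * (\<rho> * i\<^sup>2 * i ^ (2 - Suc 0))) = C * \<rho>\<^sup>2 * i ^ 3"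
      by (simp add: power2_eq_square power3_eq_cube)
    moreover have "i ^ 3 = inverse ((1 - t * \<rho>) ^ 3)"
      by (simp add: i_def power_inverse)
    ultimately show ?thesis by (simp only: divide_inverse)
  qed
  \<comment> \<open>\<open>f' - h'\<close> decreases, so \<open>f - h\<close> stays below its tangent at \<open>0\<close>.\<close>
  have slope: "f' t - h' t \<le> f' 0 - h' 0" if "0 \<le> t" "t \<le> 1" for t
  proof (rule DERIV_nonpos_imp_nonincreasing[OF that(1), of "\<lambda>t. f' t - h' t"])
    fix s assume s: "0 \<le> s" "s \<le> t"
    have deriv: "((\<lambda>t. f' t - h' t) has_real_derivative f'' s - C * \<rho>\<^sup>2 / (1 - s * \<rho>) ^ 3) (at s)"
      using s that by (intro DERIV_diff assms(2) h') auto
    have "f'' s - C * \<rho>\<^sup>2 / (1 - s * \<rho>) ^ 3 \<le> 0"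
      using assms(3)[of s] s that by simp
    with deriv show "\<exists>y. ((\<lambda>t. f' t - h' t) has_real_derivative y) (at s) \<and> y \<le> 0"
      by blast
  qed
  have "f 1 - h 1 - 1 * (f' 0 - h' 0) \<le> f 0 - h 0 - 0 * (f' 0 - h' 0)"
  proof (rule DERIV_nonpos_imp_nonincreasing[of 0 1 "\<lambda>t. f t - h t - t * (f' 0 - h' 0)"])
    fix s :: real assume s: "0 \<le> s" "s \<le> 1"
    have "((\<lambda>t. t * (f' 0 - h' 0)) has_real_derivative f' 0 - h' 0) (at s)"
      by (auto intro!: derivative_eq_intros)
    then have deriv: "((\<lambda>t. f t - h t - t * (f' 0 - h' 0)) has_real_derivative
        f' s - h' s - (f' 0 - h' 0)) (at s)"
      using s by (intro DERIV_diff assms(1) h) auto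
    have "f' s - h' s - (f' 0 - h' 0) \<le> 0"
      using slope[OF s] by simp
    with deriv show "\<exists>y. ((\<lambda>t. f t - h t - t * (f' 0 - h' 0)) has_real_derivative y) (at s) \<and> y \<le> 0"
      by blast
  qed simp
  then have "f 1 - f 0 - f' 0 \<le> h 1 - h 0 - h' 0" by simp
  also have "\<dots> = C * \<rho>\<^sup>2 / (2 * (1 - \<rho>))"
    unfolding h_def h'_def using assms(5) by (simp add: field_simps power2_eq_square)
  finally show ?thesis .
qed

lemma abs_weighted_sum_le:
  fixes \<omega> g :: "'i \<Rightarrow> real"
  assumes "\<And>i. i \<in> I \<Longrightarrow> \<omega> i \<ge> 0" and "\<And>i. i \<in> I \<Longrightarrow> \<bar>g i\<bar> \<le> B"
  shows "\<bar>\<Sum>i\<in>I. g i * \<omega> i\<bar> \<le> B * (\<Sum>i\<in>I. \<omega> i)"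
proof -
  have "\<bar>\<Sum>i\<in>I. g i * \<omega> i\<bar> \<le> (\<Sum>i\<in>I. \<bar>g i * \<omega> i\<bar>)" by (rule sum_abs)
  also have "\<dots> \<le> (\<Sum>i\<in>I. B * \<omega> i)"
    using assms by (intro sum_mono) (auto simp: abs_mult intro!: mult_right_mono)
  finally show ?thesis by (simp add: sum_distrib_left)
qed

section \<open>Second derivative of the demand along a line\<close>

lemma DERIV_powr_sum_line:
  fixes p q :: "real ^ 'n"
  assumes "\<forall>j. p $ j + t * q $ j > 0"
  shows "((\<lambda>t. \<Sum>j\<in>UNIV. b j * (p $ j + t * q $ j) powr \<kappa>) has_real_derivative
      \<kappa> * (\<Sum>j\<in>UNIV. (b j * q $ j) * (p $ j + t * q $ j) powr (\<kappa> - 1))) (at t)"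
proof -
  have "p $ j + t * q $ j > 0" for j using assms by blast
  then show ?thesis
    by (auto intro!: derivative_eq_intros sum.cong simp: sum_distrib_left)
qed

text \<open>
  The derivatives are written in terms of quotients by \<open>S t\<close>, since these are the weighted averages
  that will be bounded.
\<close>

lemma DERIV_quotient_twice:
  fixes A S :: "real \<Rightarrow> real"
  assumes "(A has_real_derivative A1) (at t)" "(A' has_real_derivative A2) (at t)" "A' t = A1"
    and "(S has_real_derivative S1) (at t)" "(S' has_real_derivative S2) (at t)" "S' t = S1"
    and "S t > 0"
  shows "((\<lambda>t. A t / S t) has_real_derivative A' t / S t - A t * S' t / (S t)\<^sup>2) (at t)"
    and "((\<lambda>t. A' t / S t - A t * S' t / (S t)\<^sup>2) has_real_derivative
      A2 / S t - 2 * (A1 / S t) * (S1 / S t) - (A t / S t) * (S2 / S t)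
      + 2 * (A t / S t) * (S1 / S t)\<^sup>2) (at t)"
proof -
  have [simp]: "S t \<noteq> 0" using assms(7) by simp
  have S_squared: "((\<lambda>t. (S t)\<^sup>2) has_real_derivative 2 * S t * S1) (at t)"
    by (rule DERIV_cong[OF DERIV_power[OF assms(4)]]) simp
  show "((\<lambda>t. A t / S t) has_real_derivative A' t / S t - A t * S' t / (S t)\<^sup>2) (at t)"
    by (rule DERIV_cong[OF DERIV_divide[OF assms(1,4)]])
      (simp_all add: assms(3,6) diff_divide_distrib power2_eq_square)
  have "((\<lambda>t. A' t / S t - A t * S' t / (S t)\<^sup>2) has_real_derivative
      (A2 * S t - A' t * S1) / (S t * S t)
      - ((A1 * S' t + S2 * A t) * (S t)\<^sup>2 - A t * S' t * (2 * S t * S1)) / ((S t)\<^sup>2 * (S t)\<^sup>2)) (at t)"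
    by (rule DERIV_diff[OF DERIV_divide[OF assms(2,4)]
        DERIV_divide[OF DERIV_mult[OF assms(1,5)] S_squared]]) simp_all
  then show "((\<lambda>t. A' t / S t - A t * S' t / (S t)\<^sup>2) has_real_derivative
      A2 / S t - 2 * (A1 / S t) * (S1 / S t) - (A t / S t) * (S2 / S t)
      + 2 * (A t / S t) * (S1 / S t)\<^sup>2) (at t)"
    by (rule DERIV_cong) (simp add: assms(3,6), simp add: divide_simps, simp add: power2_eq_square power4_eq_xxxx algebra_simps)
qed

text \<open>
  The left-hand side is the sum of the absolute values of the coefficients in the second
  derivative of the demand along a line. For \<open>\<sigma> \<le> 1\<close> it
  is the constant \<open>2\<close>, and for \<open>\<sigma> \<ge> 1\<close> it is \<open>6 \<sigma>\<^sup>2 - 6 \<sigma> + 2\<close>.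
\<close>

lemma ces_constant_le:
  fixes \<sigma> :: real
  assumes "\<sigma> > 0"
  shows "\<sigma> * (\<sigma> + 1) + 2 * \<sigma> * \<bar>1 - \<sigma>\<bar> + \<sigma> * \<bar>1 - \<sigma>\<bar> + 2 * (1 - \<sigma>)\<^sup>2 \<le> max (6 * \<sigma>\<^sup>2) 2"
proof (cases "\<sigma> \<ge> 1")
  case True
  then have "\<sigma> * (\<sigma> + 1) + 2 * \<sigma> * \<bar>1 - \<sigma>\<bar> + \<sigma> * \<bar>1 - \<sigma>\<bar> + 2 * (1 - \<sigma>)\<^sup>2 = 6 * \<sigma>\<^sup>2 - (6 * \<sigma> - 2)"
    by (simp add: power2_eq_square algebra_simps)
  then show ?thesis using True by simp
next
  case False
  then have "\<sigma> * (\<sigma> + 1) + 2 * \<sigma> * \<bar>1 - \<sigma>\<bar> + \<sigma> * \<bar>1 - \<sigma>\<bar> + 2 * (1 - \<sigma>)\<^sup>2 = 2"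
    by (simp add: power2_eq_square algebra_simps)
  then show ?thesis by simp
qed

text \<open>
  Here \<open>E\<^sub>n\<close> and \<open>V\<^sub>n\<close> stand for the weighted averages of \<open>\<epsilon> \<eta>\<^sup>n\<close> and \<open>\<eta>\<^sup>n\<close>. Every product that occurs
  has total degree two in \<open>\<eta>\<close> and one in \<open>\<epsilon>\<close>, so it is at most \<open>\<rho>\<^sup>2 M\<^sup>3\<close>.
\<close>

lemma quotient_second_derivative_bound:
  fixes \<sigma> :: real
  assumes "\<sigma> > 0" and "M \<ge> 0" and "\<rho> \<ge> 0"
    and E: "\<bar>E0\<bar> \<le> M" "\<bar>E1\<bar> \<le> \<rho> * M\<^sup>2" "\<bar>E2\<bar> \<le> \<rho>\<^sup>2 * M ^ 3"
    and V: "\<bar>V1\<bar> \<le> \<rho> * M" "\<bar>V2\<bar> \<le> \<rho>\<^sup>2 * M\<^sup>2"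
  shows "\<sigma> * (\<sigma> + 1) * E2 - 2 * (- \<sigma> * E1) * ((1 - \<sigma>) * V1) - E0 * ((1 - \<sigma>) * (- \<sigma>) * V2)
      + 2 * E0 * ((1 - \<sigma>) * V1)\<^sup>2 \<le> max (6 * \<sigma>\<^sup>2) 2 * (\<rho>\<^sup>2 * M ^ 3)"
    (is "?L \<le> _ * ?N")
proof -
  have "?L = \<sigma> * (\<sigma> + 1) * E2 + 2 * \<sigma> * (1 - \<sigma>) * (E1 * V1) + \<sigma> * (1 - \<sigma>) * (E0 * V2)
      + 2 * (1 - \<sigma>)\<^sup>2 * (E0 * V1\<^sup>2)"
    by (simp add: power2_eq_square algebra_simps)
  also have "\<dots> \<le> \<bar>\<sigma> * (\<sigma> + 1) * E2\<bar> + \<bar>2 * \<sigma> * (1 - \<sigma>) * (E1 * V1)\<bar>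
      + \<bar>\<sigma> * (1 - \<sigma>) * (E0 * V2)\<bar> + \<bar>2 * (1 - \<sigma>)\<^sup>2 * (E0 * V1\<^sup>2)\<bar>" by linarith
  also have "\<dots> = \<sigma> * (\<sigma> + 1) * \<bar>E2\<bar> + 2 * \<sigma> * \<bar>1 - \<sigma>\<bar> * \<bar>E1 * V1\<bar>
      + \<sigma> * \<bar>1 - \<sigma>\<bar> * \<bar>E0 * V2\<bar> + 2 * (1 - \<sigma>)\<^sup>2 * \<bar>E0 * V1\<^sup>2\<bar>"
    using assms(1) by (simp add: abs_mult)
  also have "\<dots> \<le> \<sigma> * (\<sigma> + 1) * ?N + 2 * \<sigma> * \<bar>1 - \<sigma>\<bar> * ?N
      + \<sigma> * \<bar>1 - \<sigma>\<bar> * ?N + 2 * (1 - \<sigma>)\<^sup>2 * ?N"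
  proof -
    have "\<bar>E1 * V1\<bar> \<le> (\<rho> * M\<^sup>2) * (\<rho> * M)"
      using E V assms(2,3) unfolding abs_mult by (intro mult_mono) auto
    moreover have "\<bar>E0 * V2\<bar> \<le> M * (\<rho>\<^sup>2 * M\<^sup>2)"
      using E V assms(2,3) unfolding abs_mult by (intro mult_mono) auto
    moreover have "\<bar>E0 * V1\<^sup>2\<bar> \<le> M * (\<rho> * M)\<^sup>2"
      using E V assms(2,3) unfolding abs_mult power_abs by (intro mult_mono power_mono) auto
    ultimately have "\<bar>E1 * V1\<bar> \<le> ?N" "\<bar>E0 * V2\<bar> \<le> ?N" "\<bar>E0 * V1\<^sup>2\<bar> \<le> ?N"
      by (simp_all add: power2_eq_square power3_eq_cube algebra_simps)
    then show ?thesis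
      using E(3) assms(1) by (intro add_mono mult_left_mono) auto
  qed
  also have "\<dots> = (\<sigma> * (\<sigma> + 1) + 2 * \<sigma> * \<bar>1 - \<sigma>\<bar> + \<sigma> * \<bar>1 - \<sigma>\<bar> + 2 * (1 - \<sigma>)\<^sup>2) * ?N"
    by (simp add: algebra_simps)
  also have "\<dots> \<le> max (6 * \<sigma>\<^sup>2) 2 * ?N"
    using assms ces_constant_le by (intro mult_right_mono) auto
  finally show ?thesis .
qed

section \<open>Diagonal matrices and the price norm\<close>

lemma diag_mat_mult_nth: "(diag_mat p *v v) $ j = p $ j * v $ j"
  by (simp add: diag_mat_def matrix_vector_mult_def mult_delta_left)

lemma diag_mat_mult_diag_mat: "diag_mat p ** diag_mat s = diag_mat (\<chi> j. p $ j * s $ j)"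
proof -
  have "(diag_mat p ** diag_mat s) *v v = diag_mat (\<chi> j. p $ j * s $ j) *v v" for v
    by (simp add: vec_eq_iff diag_mat_mult_nth flip: matrix_vector_mul_assoc)
  then show ?thesis by (simp add: matrix_eq)
qed

text \<open>
  Of the price norm only this componentwise consequence enters the second-derivative estimate, since weighted
  averages are controlled by the largest entry.
\<close>

lemma abs_quotient_le_price_norm:
  fixes p q :: "real ^ 'n"
  assumes "\<forall>j. p $ j > 0"
  shows "\<bar>q $ j\<bar> \<le> price_norm p q * p $ j"
proof -
  define s :: "real ^ 'n" where "s = (\<chi> j. 1 / p $ j)"
  define v where "v = matrix_inv (diag_mat p) *v q"
  have "p $ j \<noteq> 0" for j using assms by (metis less_irrefl)
  then have "diag_mat p ** diag_mat s = mat 1" "diag_mat s ** diag_mat p = mat 1"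
    unfolding diag_mat_mult_diag_mat s_def by (simp_all add: diag_mat_def mat_def vec_eq_iff)
  then have "\<exists>A. diag_mat p ** A = mat 1 \<and> A ** diag_mat p = mat 1" by blast
  from someI_ex[OF this] have "diag_mat p ** matrix_inv (diag_mat p) = mat 1"
    unfolding matrix_inv_def by blast
  then have "diag_mat p *v v = q"
    unfolding v_def by (simp add: matrix_vector_mul_assoc)
  then have "q $ j = p $ j * v $ j" by (metis diag_mat_mult_nth)
  moreover have "\<bar>v $ j\<bar> \<le> price_norm p q"
    unfolding price_norm_def v_def by (rule component_le_norm_cart)
  ultimately show ?thesis using assms by (simp add: abs_mult mult.commute mult_right_mono less_imp_le)
qed

lemma norm_leI_inner:
  fixes v :: "'a :: real_inner"
  assumes "\<And>e. norm e \<le> 1 \<Longrightarrow> e \<bullet> v \<le> B"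
  shows "norm v \<le> B"
proof -
  have "sgn v \<bullet> v = norm v"
    by (cases "v = 0") (simp_all add: sgn_div_norm dot_square_norm power2_eq_square)
  then show ?thesis using assms[of "sgn v"] by (simp add: norm_sgn split: if_splits)
qed

section \<open>Linearization error of the CES demand\<close>

lemma ces_demand_differentiable:
  fixes p :: "real ^ 'n"
  assumes "\<forall>j. a j \<ge> 0" and "\<exists>j. a j > 0" and "\<forall>j. p $ j > 0"
  shows "ces_demand a \<sigma> w differentiable at p"
proof -
  have p: "p $ j > 0" for j using assms by blast
  have nth: "(\<lambda>p::real^'n. (p $ j) powr \<kappa>) differentiable at p" for j \<kappa>
    using p[of j] unfolding differentiable_def
    by (auto intro!: exI derivative_eq_intros bounded_linear.has_derivative[OF bounded_linear_vec_nth])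
  have "(\<lambda>p :: real ^ 'n. ces_demand a \<sigma> w p $ j) differentiable at p" for j
    unfolding ces_demand_def vec_lambda_beta
    using ces_price_index_pos[OF assms, of "1 - \<sigma>"]
    by (intro differentiable_divide differentiable_mult differentiable_const nth differentiable_sum ballI) auto
  then show ?thesis
    unfolding differentiable_componentwise_within[of "ces_demand a \<sigma> w"]
    by (auto simp: Basis_vec_def inner_axis)
qed

text \<open>
  The scalar estimate applied to \<open>f t = \<langle>e, P x(p + t q)\<rangle>\<close>. The factor \<open>P\<close> belongs to the initial
  prices, not to the current ones, which is why the ratio \<open>p\<^sub>j / \<pi>\<^sub>j \<le> 1 / (1 - t \<rho>)\<close> appears once more in
  the bound than the two factors \<open>\<eta>\<close>.
\<close>

lemma ces_demand_directional_remainder: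
  fixes p q e :: "real ^ 'n"
  assumes a: "\<forall>j. a j \<ge> 0" "\<exists>j. a j > 0" and p: "\<forall>j. p $ j > 0"
    and q: "\<forall>j. \<bar>q $ j\<bar> \<le> \<rho> * p $ j" and \<rho>: "0 \<le> \<rho>" "\<rho> < 1"
    and "\<sigma> > 0" and "w > 0" and "norm e \<le> 1"
    and D: "((\<lambda>t. e \<bullet> (diag_mat p *v ces_demand a \<sigma> w (p + t *\<^sub>R q))) has_real_derivative D) (at 0)"
  shows "e \<bullet> (diag_mat p *v ces_demand a \<sigma> w (p + q)) - e \<bullet> (diag_mat p *v ces_demand a \<sigma> w p) - D
    \<le> w * max (6 * \<sigma>\<^sup>2) 2 * \<rho>\<^sup>2 / (2 * (1 - \<rho>))"
proof -
  define b where "b j = e $ j * p $ j * a j" for j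
  define A where "A t = (\<Sum>j\<in>UNIV. b j * (p $ j + t * q $ j) powr (- \<sigma>))" for t
  define A' where "A' t = - \<sigma> * (\<Sum>j\<in>UNIV. (b j * q $ j) * (p $ j + t * q $ j) powr (- \<sigma> - 1))" for t
  define A2 where "A2 t = - \<sigma> * ((- \<sigma> - 1) *
    (\<Sum>j\<in>UNIV. (b j * q $ j * q $ j) * (p $ j + t * q $ j) powr (- \<sigma> - 1 - 1)))" for t
  define S where "S t = (\<Sum>j\<in>UNIV. a j * (p $ j + t * q $ j) powr (1 - \<sigma>))" for t
  define S' where "S' t = (1 - \<sigma>) * (\<Sum>j\<in>UNIV. (a j * q $ j) * (p $ j + t * q $ j) powr (1 - \<sigma> - 1))" for t
  define S2 where "S2 t = (1 - \<sigma>) * ((1 - \<sigma> - 1) *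
    (\<Sum>j\<in>UNIV. (a j * q $ j * q $ j) * (p $ j + t * q $ j) powr (1 - \<sigma> - 1 - 1)))" for t
  define f where "f t = w * (A t / S t)" for t
  define f' where "f' t = w * (A' t / S t - A t * S' t / (S t)\<^sup>2)" for t
  define f'' where "f'' t = w * (A2 t / S t - 2 * (A' t / S t) * (S' t / S t)
    - (A t / S t) * (S2 t / S t) + 2 * (A t / S t) * (S' t / S t)\<^sup>2)" for t

  have f_eq: "e \<bullet> (diag_mat p *v ces_demand a \<sigma> w (p + t *\<^sub>R q)) = f t" for t
  proof -
    have "e \<bullet> (diag_mat p *v ces_demand a \<sigma> w (p + t *\<^sub>R q))
        = (\<Sum>j\<in>UNIV. w / S t * (b j * (p $ j + t * q $ j) powr (- \<sigma>)))"
      unfolding inner_vec_def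
      by (rule sum.cong) (simp_all add: diag_mat_mult_nth ces_demand_def S_def b_def)
    also have "\<dots> = w / S t * A t" unfolding A_def by (rule sum_distrib_left[symmetric])
    finally show ?thesis by (simp add: f_def)
  qed

  have price_ge: "p $ j + t * q $ j \<ge> p $ j * (1 - t * \<rho>)"
    and shrink: "1 - t * \<rho> > 0"
    and price_pos: "p $ j + t * q $ j > 0" if t: "0 \<le> t" "t \<le> 1" for t j
  proof -
    have "t * \<rho> \<le> 1 * \<rho>" using t \<rho> by (intro mult_right_mono) auto
    then show less: "1 - t * \<rho> > 0" using \<rho> by simp
    have "t * \<bar>q $ j\<bar> \<le> t * (\<rho> * p $ j)" using q t by (intro mult_left_mono) auto
    moreover have "- (t * q $ j) \<le> t * \<bar>q $ j\<bar>"
      using t by (metis abs_ge_minus_self abs_mult abs_of_nonneg)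
    ultimately show ge: "p $ j + t * q $ j \<ge> p $ j * (1 - t * \<rho>)" by (simp add: algebra_simps)
    have "p $ j * (1 - t * \<rho>) > 0" using p less by simp
    with ge show "p $ j + t * q $ j > 0" by linarith
  qed

  have S_pos: "S t > 0" if "0 \<le> t" "t \<le> 1" for t
    using ces_price_index_pos[OF a, of "p + t *\<^sub>R q" "1 - \<sigma>"] price_pos[OF that] by (simp add: S_def)

  have derivs: "(f has_real_derivative f' t) (at t)" "(f' has_real_derivative f'' t) (at t)"
    if t: "0 \<le> t" "t \<le> 1" for t
  proof -
    have pos: "\<forall>j. p $ j + t * q $ j > 0" using price_pos[OF t] by blast
    have "(A has_real_derivative A' t) (at t)" "(S has_real_derivative S' t) (at t)"
      unfolding A_def[abs_def] A'_def S_def[abs_def] S'_def by (rule DERIV_powr_sum_line[OF pos])+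
    moreover have "(A' has_real_derivative A2 t) (at t)" "(S' has_real_derivative S2 t) (at t)"
      unfolding A2_def A'_def[abs_def] S2_def S'_def[abs_def]
      by (rule DERIV_cmult, rule DERIV_powr_sum_line[OF pos])+
    ultimately show "(f has_real_derivative f' t) (at t)" "(f' has_real_derivative f'' t) (at t)"
      unfolding f_def[abs_def] f'_def[abs_def] f''_def
      using S_pos[OF t] by (intro DERIV_cmult DERIV_quotient_twice; simp)+
  qed

  have second: "f'' t \<le> (w * max (6 * \<sigma>\<^sup>2) 2) * \<rho>\<^sup>2 / (1 - t * \<rho>) ^ 3" if t: "0 \<le> t" "t \<le> 1" for t
  proof -
    define M where "M = 1 / (1 - t * \<rho>)"
    define \<omega> where "\<omega> j = a j * (p $ j + t * q $ j) powr (1 - \<sigma>)" for j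
    define \<epsilon> where "\<epsilon> j = e $ j * p $ j / (p $ j + t * q $ j)" for j
    define \<eta> where "\<eta> j = q $ j / (p $ j + t * q $ j)" for j
    have M: "M > 0" using shrink[OF t] by (simp add: M_def)
    have S: "S t = (\<Sum>j\<in>UNIV. \<omega> j)" by (simp add: S_def \<omega>_def)
    have \<omega>: "\<omega> j \<ge> 0" for j using a by (simp add: \<omega>_def)
    have ratio: "p $ j / (p $ j + t * q $ j) \<le> M" for j
      using price_ge[OF t, of j] price_pos[OF t, of j] shrink[OF t] by (simp add: M_def field_simps)
    have \<epsilon>: "\<bar>\<epsilon> j\<bar> \<le> M" for j
    proof -
      have "\<bar>e $ j\<bar> \<le> 1" using \<open>norm e \<le> 1\<close> component_le_norm_cart order_trans by blast
      moreover have "\<bar>\<epsilon> j\<bar> = \<bar>e $ j\<bar> * (p $ j / (p $ j + t * q $ j))"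
        using p price_pos[OF t, of j] by (simp add: \<epsilon>_def abs_mult less_imp_le)
      ultimately have "\<bar>\<epsilon> j\<bar> \<le> 1 * M"
        using ratio p price_pos[OF t, of j] by (metis abs_ge_zero divide_nonneg_pos less_imp_le mult_mono zero_le_one)
      then show ?thesis by simp
    qed
    have \<eta>: "\<bar>\<eta> j\<bar> \<le> \<rho> * M" for j
    proof -
      have "\<bar>\<eta> j\<bar> \<le> \<rho> * p $ j / (p $ j + t * q $ j)"
        using q price_pos[OF t, of j] by (simp add: \<eta>_def divide_right_mono)
      also have "\<dots> \<le> \<rho> * M" using ratio[of j] \<rho> mult_left_mono by fastforce
      finally show ?thesis .
    qed
    have step: "(p $ j + t * q $ j) powr (\<kappa> - 1) = (p $ j + t * q $ j) powr \<kappa> / (p $ j + t * q $ j)" for j \<kappa>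
      using price_pos[OF t, of j] by (simp add: powr_diff)
    \<comment> \<open>Lowering an exponent by one divides by \<open>\<pi>\<^sub>j\<close>, which turns a factor \<open>q\<^sub>j\<close> into \<open>\<eta>\<^sub>j\<close>.\<close>
    have A: "A t = (\<Sum>j\<in>UNIV. \<epsilon> j * \<omega> j)"
      and A': "A' t = - \<sigma> * (\<Sum>j\<in>UNIV. (\<epsilon> j * \<eta> j) * \<omega> j)"
      and A2: "A2 t = \<sigma> * (\<sigma> + 1) * (\<Sum>j\<in>UNIV. (\<epsilon> j * (\<eta> j)\<^sup>2) * \<omega> j)"
      and S': "S' t = (1 - \<sigma>) * (\<Sum>j\<in>UNIV. \<eta> j * \<omega> j)"
      and S2: "S2 t = (1 - \<sigma>) * (- \<sigma>) * (\<Sum>j\<in>UNIV. (\<eta> j)\<^sup>2 * \<omega> j)"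
    proof -
      have \<sigma>: "- \<sigma> = 1 - \<sigma> - 1" by simp
      have "b j * (p $ j + t * q $ j) powr (- \<sigma>) = \<epsilon> j * \<omega> j" for j
        unfolding \<sigma> step by (simp add: b_def \<epsilon>_def \<omega>_def)
      then show "A t = (\<Sum>j\<in>UNIV. \<epsilon> j * \<omega> j)" unfolding A_def by simp
      have "b j * q $ j * (p $ j + t * q $ j) powr (- \<sigma> - 1) = (\<epsilon> j * \<eta> j) * \<omega> j" for j
        unfolding \<sigma> step by (simp add: b_def \<epsilon>_def \<omega>_def \<eta>_def)
      then show "A' t = - \<sigma> * (\<Sum>j\<in>UNIV. (\<epsilon> j * \<eta> j) * \<omega> j)" unfolding A'_def by simp
      have "b j * q $ j * q $ j * (p $ j + t * q $ j) powr (- \<sigma> - 1 - 1) = (\<epsilon> j * (\<eta> j)\<^sup>2) * \<omega> j" for j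
        unfolding \<sigma> step by (simp add: b_def \<epsilon>_def \<omega>_def \<eta>_def power2_eq_square mult_ac)
      then have "A2 t = - \<sigma> * ((- \<sigma> - 1) * (\<Sum>j\<in>UNIV. (\<epsilon> j * (\<eta> j)\<^sup>2) * \<omega> j))" unfolding A2_def by simp
      then show "A2 t = \<sigma> * (\<sigma> + 1) * (\<Sum>j\<in>UNIV. (\<epsilon> j * (\<eta> j)\<^sup>2) * \<omega> j)" by algebra
      have "a j * q $ j * (p $ j + t * q $ j) powr (1 - \<sigma> - 1) = \<eta> j * \<omega> j" for j
        unfolding step by (simp add: \<omega>_def \<eta>_def)
      then show "S' t = (1 - \<sigma>) * (\<Sum>j\<in>UNIV. \<eta> j * \<omega> j)" unfolding S'_def by simp
      have "a j * q $ j * q $ j * (p $ j + t * q $ j) powr (1 - \<sigma> - 1 - 1) = (\<eta> j)\<^sup>2 * \<omega> j" for j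
        unfolding step by (simp add: \<omega>_def \<eta>_def power2_eq_square)
      then have "S2 t = (1 - \<sigma>) * ((1 - \<sigma> - 1) * (\<Sum>j\<in>UNIV. (\<eta> j)\<^sup>2 * \<omega> j))" unfolding S2_def by simp
      then show "S2 t = (1 - \<sigma>) * (- \<sigma>) * (\<Sum>j\<in>UNIV. (\<eta> j)\<^sup>2 * \<omega> j)" by algebra
    qed
    have average: "\<bar>(\<Sum>j\<in>UNIV. g j * \<omega> j) / S t\<bar> \<le> B" if "\<And>j. \<bar>g j\<bar> \<le> B" for g B
      using abs_weighted_sum_le[of UNIV \<omega> g B] \<omega> that S_pos[OF t]
      by (simp add: S[symmetric] pos_divide_le_eq)
    have \<eta>2: "\<bar>(\<eta> j)\<^sup>2\<bar> \<le> \<rho>\<^sup>2 * M\<^sup>2" for j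
      using power_mono[OF \<eta>[of j], of 2] by (simp add: power_mult_distrib)
    have bound1: "\<bar>\<epsilon> j * \<eta> j\<bar> \<le> \<rho> * M\<^sup>2" for j
      using mult_mono[OF \<epsilon>[of j] \<eta>[of j]] M by (simp add: abs_mult power2_eq_square mult_ac)
    have bound2: "\<bar>\<epsilon> j * (\<eta> j)\<^sup>2\<bar> \<le> \<rho>\<^sup>2 * M ^ 3" for j
      using mult_mono[OF \<epsilon>[of j] \<eta>2[of j]] M
      by (simp add: abs_mult power2_eq_square power3_eq_cube mult_ac)
    have "A2 t / S t - 2 * (A' t / S t) * (S' t / S t)
      - (A t / S t) * (S2 t / S t) + 2 * (A t / S t) * (S' t / S t)\<^sup>2 \<le> max (6 * \<sigma>\<^sup>2) 2 * (\<rho>\<^sup>2 * M ^ 3)"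
      using quotient_second_derivative_bound[OF \<open>\<sigma> > 0\<close> less_imp_le[OF M] \<rho>(1) average[OF \<epsilon>]
          average[OF bound1] average[OF bound2] average[OF \<eta>] average[OF \<eta>2]]
      unfolding A A' A2 S' S2 times_divide_eq_right[symmetric] .
    then have "f'' t \<le> w * (max (6 * \<sigma>\<^sup>2) 2 * (\<rho>\<^sup>2 * M ^ 3))"
      unfolding f''_def using \<open>w > 0\<close> by (intro mult_left_mono) auto
    then show ?thesis by (simp add: M_def power_divide mult.assoc)
  qed

  have "D = f' 0"
    using D derivs(1)[of 0] unfolding f_eq by (auto intro: DERIV_unique)
  then show ?thesis
    using second_order_remainder_le[OF derivs second \<rho>] f_eq[of 0] f_eq[of 1] by simp
qed

text \<open>
  Testing the error vector against all \<open>e\<close> with \<open>\<parallel>e\<parallel> \<le> 1\<close> loses nothing and avoids integrating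
  vector-valued functions.
\<close>

lemma ces_demand_remainder:
  fixes p q :: "real ^ 'n"
  assumes a: "\<forall>j. a j \<ge> 0" "\<exists>j. a j > 0" and p: "\<forall>j. p $ j > 0"
    and \<rho>: "price_norm p q < 1" and "\<sigma> > 0" and "w > 0"
    and F': "(ces_demand a \<sigma> w has_derivative F') (at p)"
  shows "norm (diag_mat p *v (ces_demand a \<sigma> w (p + q) - ces_demand a \<sigma> w p - F' q))
    \<le> w * max (6 * \<sigma>\<^sup>2) 2 * (price_norm p q)\<^sup>2 / (2 * (1 - price_norm p q))"
proof (rule norm_leI_inner)
  fix e :: "real ^ 'n"
  assume e: "norm e \<le> 1"
  define L where "L v = e \<bullet> (diag_mat p *v v)" for v
  have L: "bounded_linear L"
    unfolding L_def[abs_def]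
    by (intro bounded_linear_compose[OF bounded_linear_inner_right matrix_vector_mul_bounded_linear])
  have "((\<lambda>t::real. p + t *\<^sub>R q) has_derivative (\<lambda>t. t *\<^sub>R q)) (at 0)"
    by (auto intro!: derivative_eq_intros)
  then have "((\<lambda>t. ces_demand a \<sigma> w (p + t *\<^sub>R q)) has_derivative (\<lambda>t. F' (t *\<^sub>R q))) (at 0)"
    by (rule has_derivative_compose) (use F' in simp)
  then have "((\<lambda>t. L (ces_demand a \<sigma> w (p + t *\<^sub>R q))) has_derivative (\<lambda>t. L (F' (t *\<^sub>R q)))) (at 0)"
    by (rule bounded_linear.has_derivative[OF L])
  moreover have "(\<lambda>t. L (F' (t *\<^sub>R q))) = (*) (L (F' q))"
    using bounded_linear.linear[OF L] has_derivative_linear[OF F']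
    by (auto simp: linear_scale)
  ultimately have "((\<lambda>t. L (ces_demand a \<sigma> w (p + t *\<^sub>R q))) has_real_derivative L (F' q)) (at 0)"
    by (simp add: has_field_derivative_def)
  from ces_demand_directional_remainder[OF a p _ _ \<rho> \<open>\<sigma> > 0\<close> \<open>w > 0\<close> e this[unfolded L_def]]
  show "e \<bullet> (diag_mat p *v (ces_demand a \<sigma> w (p + q) - ces_demand a \<sigma> w p - F' q))
    \<le> w * max (6 * \<sigma>\<^sup>2) 2 * (price_norm p q)\<^sup>2 / (2 * (1 - price_norm p q))"
    using abs_quotient_le_price_norm[OF p] norm_ge_zero
    by (auto simp: price_norm_def matrix_vector_mult_diff_distrib inner_diff_right)
qed

section \<open>Best responses in the utility class\<close>

theorem theorem3p3:
  fixes u :: "real ^ 'n \<Rightarrow> ennreal"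
    and k r d w \<rho> T :: real
    and p q :: "real ^ 'n"
  assumes "u \<in> utility_class k r"
    and "d = k * r"
    and "(0 < r \<and> r < 1 \<and> 0 < k \<and> k \<le> 1 / r) \<or> (r < 0 \<and> 1 / r \<le> k \<and> k < 0)"
    and "w > 0"
    and "\<forall>j. p $ j > 0"
    and "\<rho> = price_norm p q"
    and "\<rho> < 1"
    and "T = max (6 * d / (1 - r)\<^sup>2) (2 * d)"
  shows "best_response u w differentiable (at p) \<and>
    norm (diag_mat p *v (best_response u w (p + q) - best_response u w p
                         - jacobian (best_response u w) (at p) *v q))
      \<le> w / d * (T * \<rho>\<^sup>2 / (2 * (1 - \<rho>)))"
proof -
  define \<sigma> where "\<sigma> = 1 / (1 - r)"
  have sign: "0 < r \<and> 0 < k \<or> r < 0 \<and> k < 0" and "r < 1" "r \<noteq> 0" "\<sigma> > 0"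
    using assms(3) by (auto simp: \<sigma>_def)
  then have "d > 0" using assms(2) by (auto simp: mult_neg_neg)
  have "T = d * max (6 * \<sigma>\<^sup>2) 2"
    using \<open>d > 0\<close> by (simp add: assms(8) \<sigma>_def max_mult_distrib_left power_divide mult.commute)
  then have rhs: "w / d * (T * \<rho>\<^sup>2 / (2 * (1 - \<rho>))) = w * max (6 * \<sigma>\<^sup>2) 2 * \<rho>\<^sup>2 / (2 * (1 - \<rho>))"
    using \<open>d > 0\<close> by simp
  have rhs_nonneg: "w * max (6 * \<sigma>\<^sup>2) 2 * \<rho>\<^sup>2 / (2 * (1 - \<rho>)) \<ge> 0"
    using assms(4,7) by (intro divide_nonneg_nonneg mult_nonneg_nonneg) auto
  obtain \<theta> where \<theta>: "\<forall>j. homogeneous_summand r (\<theta> j)"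
    and u: "\<forall>x. (\<forall>j. x $ j \<ge> 0) \<longrightarrow> u x = ennreal_pow (\<Sum>j\<in>UNIV. \<theta> j (x $ j)) k"
    using assms(1) unfolding utility_class_def by blast
  define a where "a = (\<lambda>j. enn2real (\<theta> j 1) powr \<sigma>)"
  \<comment> \<open>The second branch is the unspecified vector taken when there is no unique maximizer.\<close>
  define F where "F = (if \<exists>j. enn2real (\<theta> j 1) > 0 then ces_demand a \<sigma> w else (\<lambda>_. THE y. False))"
  define Q where "Q = {p :: real ^ 'n. \<forall>j. p $ j > 0}"
  have best_response: "best_response u w p' = F p'" if "p' \<in> Q" for p'
  proof (cases "\<exists>j. enn2real (\<theta> j 1) > 0")
    case True
    then show ?thesis
      using best_response_eq_ces_demand[OF \<theta> u sign \<open>r < 1\<close> True assms(4)] that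
      by (simp add: F_def a_def \<sigma>_def Q_def)
  next
    case False
    then have "\<forall>j. enn2real (\<theta> j 1) = 0" by (meson antisym enn2real_nonneg not_le)
    then show ?thesis
      using no_unique_maximizer_if_summands_vanish[OF \<theta> u \<open>r \<noteq> 0\<close> _ assms(4)] that False
      by (simp add: F_def best_response_def Q_def)
  qed
  have "open Q"
  proof -
    have "Q = (\<Inter>j. {p. p $ j > 0})" by (auto simp: Q_def)
    moreover have "open {p :: real ^ 'n. p $ j > 0}" for j
      by (intro open_Collect_less continuous_intros)
    ultimately show ?thesis by (metis open_INT finite)
  qed
  have "p \<in> Q" using assms(5) by (simp add: Q_def)
  have "p $ j + q $ j > 0" for j
  proof -
    have "\<bar>q $ j\<bar> \<le> \<rho> * p $ j" using abs_quotient_le_price_norm assms(5,6) by blast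
    also have "\<rho> * p $ j < 1 * p $ j" using assms(5,7) by (intro mult_strict_right_mono) auto
    finally show ?thesis by linarith
  qed
  then have "p + q \<in> Q" by (simp add: Q_def)
  have F_diff_bound: "F differentiable (at p) \<and> (\<forall>F'. (F has_derivative F') (at p) \<longrightarrow>
      norm (diag_mat p *v (F (p + q) - F p - F' q)) \<le> w * max (6 * \<sigma>\<^sup>2) 2 * \<rho>\<^sup>2 / (2 * (1 - \<rho>)))"
  proof (cases "\<exists>j. enn2real (\<theta> j 1) > 0")
    case True
    then have a: "\<forall>j. a j \<ge> 0" "\<exists>j. a j > 0"
      unfolding a_def by (simp_all, metis less_irrefl)
    show ?thesis
      using True ces_demand_differentiable[OF a assms(5)]
        ces_demand_remainder[OF a assms(5) _ \<open>\<sigma> > 0\<close> assms(4), of q] assms(6,7)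
      by (simp add: F_def)
  next
    case False
    then have F: "F = (\<lambda>_. THE y. False)" by (simp add: F_def)
    have "norm (diag_mat p *v (F (p + q) - F p - F' q)) \<le> w * max (6 * \<sigma>\<^sup>2) 2 * \<rho>\<^sup>2 / (2 * (1 - \<rho>))"
      if "(F has_derivative F') (at p)" for F'
    proof -
      have "F' q = 0"
        using has_derivative_unique[OF that[unfolded F] has_derivative_const] by simp
      then show ?thesis using rhs_nonneg by (simp add: F)
    qed
    moreover have "F differentiable (at p)" by (simp add: F)
    ultimately show ?thesis by blast
  qed
  obtain F' where "(F has_derivative F') (at p)" using F_diff_bound by (auto simp: differentiable_def)
  then have "(best_response u w has_derivative F') (at p)"
    using \<open>open Q\<close> \<open>p \<in> Q\<close> by (rule has_derivative_transform_within_open) (simp add: best_response)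
  then have diff: "best_response u w differentiable (at p)" by (rule differentiableI)
  then have "(best_response u w has_derivative (\<lambda>h. jacobian (best_response u w) (at p) *v h)) (at p)"
    by (simp add: jacobian_works)
  then have "(F has_derivative (\<lambda>h. jacobian (best_response u w) (at p) *v h)) (at p)"
    using \<open>open Q\<close> \<open>p \<in> Q\<close> by (rule has_derivative_transform_within_open) (simp add: best_response)
  with F_diff_bound diff show ?thesis
    using best_response \<open>p \<in> Q\<close> \<open>p + q \<in> Q\<close> by (simp only: rhs)
qed

end
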